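(* Consider the (unbiased, $(1:1)$, Maker moving first) Maker--Breaker directed triangle game played on the parity tournament $\Pi(n)$ on $n$ vertices. If $n\le 6$, then Breaker has a winning strategy. If $n\ge 7$, then Maker has a winning strategy.
   Context: Let $V_n=\{1,2,\ldots,n\}$, and let $(i,j)$ denote the directed edge from $i$ to $j$. A tournament on $V_n$ is a directed graph containing, for all distinct $i,j\in V_n$, precisely one of $(i,j)$ and $(j,i)$, with no loops or parallel edges. Parity tournament $\Pi(n)$: the tournament on $V_n$ in which, for $i<j$, the edge is $(i,j)$ if $i+j$ is odd, and is $(j,i)$ if $i+j$ is even. A directed triangle $(i,j,k)$ in a tournament $T$ consists of three distinct vertices $i,j,k$ with $(i,j),(j,k),(k,i)\in E(T)$. Maker--Breaker directed triangle game on a tournament $T$: the board is the edge set $E(T)$. Maker moves first; the two players alternate, Maker claiming one previously untaken edge in each of her turns and Breaker claiming (deleting) one previously untaken edge in each of hers, until all edges are exhausted. Maker wins if at the end she has claimed all three edges of some directed triangle of $T$; otherwise Breaker wins. *)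

theory Defs
  imports "Graph_Theory.Pair_Digraph"
begin

section \<open>Tournaments\<close>

text \<open>Loops and parallel edges are excluded by \<^locale>\<open>pair_digraph\<close>.\<close>

locale tournament = pair_digraph T for T :: "'a pair_pre_digraph" +
  assumes exactly_one_arc:
    "\<lbrakk>i \<in> pverts T; j \<in> pverts T; i \<noteq> j\<rbrakk> \<Longrightarrow> (i, j) \<in> parcs T \<longleftrightarrow> (j, i) \<notin> parcs T"

definition parity_tournament :: "nat \<Rightarrow> nat pair_pre_digraph" where
  "parity_tournament n =
    \<lparr> pverts = {1..n},
      parcs = {(i, j). i \<in> {1..n} \<and> j \<in> {1..n} \<and> i < j \<and> odd (i + j)}
            \<union> {(j, i) | i j. i \<in> {1..n} \<and> j \<in> {1..n} \<and> i < j \<and> even (i + j)} \<rparr>"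

lemma tournament_parity_tournament: "tournament (parity_tournament n)"
proof
  show "finite (pverts (parity_tournament n))"
    by (simp add: parity_tournament_def)
  show "finite (parcs (parity_tournament n))"
    by (rule finite_subset[of _ "{1..n} \<times> {1..n}"]) (auto simp: parity_tournament_def)
qed (auto simp: parity_tournament_def)

definition directed_triangle :: "'a pair_pre_digraph \<Rightarrow> 'a \<Rightarrow> 'a \<Rightarrow> 'a \<Rightarrow> bool" where
  "directed_triangle T i j k \<longleftrightarrow>
     i \<in> pverts T \<and> j \<in> pverts T \<and> k \<in> pverts T \<and> i \<noteq> j \<and> j \<noteq> k \<and> i \<noteq> k \<and>
     (i, j) \<in> parcs T \<and> (j, k) \<in> parcs T \<and> (k, i) \<in> parcs T"


section \<open>Maker--Breaker games\<close>

text \<open>A position is the list of all moves made so far, in chronological order. Maker moves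
  first, so she is to move exactly when the length is even. On a finite board \<open>X\<close> the
  game has ended when \<open>set p = X\<close>.\<close>

datatype player = Maker | Breaker

definition position :: "'e set \<Rightarrow> 'e list \<Rightarrow> bool" where
  "position X p \<longleftrightarrow> distinct p \<and> set p \<subseteq> X"

definition to_move :: "'e list \<Rightarrow> player" where
  "to_move p = (if even (length p) then Maker else Breaker)"

definition claimed :: "player \<Rightarrow> 'e list \<Rightarrow> 'e set" where
  "claimed P p = {p ! m | m. m < length p \<and> to_move (take m p) = P}"

text \<open>A strategy maps the whole history to the next move; it has to be legal at every
  unfinished position at which its owner is to move.\<close>

definition strategy :: "player \<Rightarrow> 'e set \<Rightarrow> ('e list \<Rightarrow> 'e) \<Rightarrow> bool" where
  "strategy P X s \<longleftrightarrow>
     (\<forall>p. position X p \<and> set p \<noteq> X \<and> to_move p = P \<longrightarrow> s p \<in> X - set p)"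

definition follows :: "player \<Rightarrow> ('e list \<Rightarrow> 'e) \<Rightarrow> 'e list \<Rightarrow> bool" where
  "follows P s p \<longleftrightarrow> (\<forall>m < length p. to_move (take m p) = P \<longrightarrow> p ! m = s (take m p))"

text \<open>The winner of a finished game, where \<open>F\<close> is the family of winning sets.\<close>

definition winner :: "'e set set \<Rightarrow> 'e list \<Rightarrow> player" where
  "winner F p = (if \<exists>A\<in>F. A \<subseteq> claimed Maker p then Maker else Breaker)"

definition has_winning_strategy :: "player \<Rightarrow> 'e set \<Rightarrow> 'e set set \<Rightarrow> bool" where
  "has_winning_strategy P X F \<longleftrightarrow>
     (\<exists>s. strategy P X s \<and>
          (\<forall>p. position X p \<and> set p = X \<and> follows P s p \<longrightarrow> winner F p = P))"


section \<open>The directed triangle game\<close>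

definition triangle_edge_sets :: "'a pair_pre_digraph \<Rightarrow> ('a \<times> 'a) set set" where
  "triangle_edge_sets T = {{(i, j), (j, k), (k, i)} | i j k. directed_triangle T i j k}"

definition wins_triangle_game :: "player \<Rightarrow> 'a pair_pre_digraph \<Rightarrow> bool" where
  "wins_triangle_game P T \<longleftrightarrow> has_winning_strategy P (parcs T) (triangle_edge_sets T)"

end

theory Submission
  imports Defs
begin

text \<open>A position is summarised by the hypergraph of those winning sets that Breaker has not hit,
  with Maker's elements removed from them: Maker's moves contract this hypergraph and Breaker's
  moves delete from it.

  The directed triangles of \<open>\<Pi>(n)\<close> are the triples \<open>i < j < k\<close> of alternating parity; write \<open>ij\<close> for
  the arc between \<open>i\<close> and \<open>j\<close>, whatever its direction.

  For \<open>n = 6\<close>, the triangles avoiding \<open>25\<close> can be listed so that each of them has two arcs lying in no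
  earlier one. By pairing such arcs, Breaker survives on these triangles even if Maker makes two
  moves before his first reply, so he answers by taking \<open>25\<close>. If Maker opens with \<open>25\<close> herself, Breaker
  takes \<open>12\<close>, which destroys the triangle \<open>125\<close>, and next one of the arcs \<open>26\<close>, \<open>56\<close>, which
  destroys \<open>256\<close>.

  For \<open>n = 7\<close>, Maker opens with \<open>12\<close>. Whatever Breaker answers, it does not interfere with one of the
  following three sequences of threats (Breaker's forced replies in parentheses), each of which
  ends in a double threat: \<open>17 (27), 15 (25), 14\<close>, or \<open>23 (13), 25 (15), 26\<close>, or
  \<open>23 (13), 34 (24), 17 (27), 47\<close>. For larger \<open>n\<close> she wins on the triangles of \<open>\<Pi>(7)\<close>, because additional
  winning sets never hurt her.\<close>

section \<open>The game on the residual hypergraph\<close>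

definition contract :: "'e \<Rightarrow> 'e set set \<Rightarrow> 'e set set" where
  "contract e H = (\<lambda>A. A - {e}) ` H"

definition delete :: "'e \<Rightarrow> 'e set set \<Rightarrow> 'e set set" where
  "delete f H = {A \<in> H. f \<notin> A}"

definition residual :: "'e set set \<Rightarrow> 'e set \<Rightarrow> 'e set \<Rightarrow> 'e set set" where
  "residual F M B = (\<lambda>A. A - M) ` {A \<in> F. A \<inter> B = {}}"

text \<open>Maker is to move. Neither \<open>e\<close> nor \<open>f\<close> has to lie in a member of \<open>H\<close>; the choice \<open>f = e\<close>
  amounts to a pass by Breaker.\<close>

inductive maker_wins :: "'e set set \<Rightarrow> bool" where
  won: "{} \<in> H \<Longrightarrow> maker_wins H"
| move: "(\<And>f. maker_wins (delete f (contract e H))) \<Longrightarrow> maker_wins H"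

lemma residual_empty [simp]: "residual F {} {} = F"
  by (auto simp: residual_def)

lemma contract_residual: "contract e (residual F M B) = residual F (insert e M) B"
  by (simp only: contract_def residual_def image_image Diff_insert[symmetric])

text \<open>The premise matters: an arc of \<open>M\<close> has been stripped from every member, so
  deleting it would remove nothing, whereas adding it to \<open>B\<close> would discard
  sets.\<close>

lemma delete_residual: "f \<notin> M \<Longrightarrow> delete f (residual F M B) = residual F M (insert f B)"
  unfolding delete_def residual_def by auto

lemma contract_insert: "contract e (insert A H) = insert (A - {e}) (contract e H)"
  by (simp add: contract_def)

lemma contract_idle: "e \<notin> \<Union>H \<Longrightarrow> contract e H = H"
  unfolding contract_def by (force simp: image_def)

lemma delete_idle: "f \<notin> \<Union>H \<Longrightarrow> delete f H = H"
  by (auto simp: delete_def)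

lemma contract_commute: "contract e (contract a H) = contract a (contract e H)"
  by (simp add: contract_def image_image Diff_insert2[symmetric] insert_commute)

lemma delete_contract: "f \<noteq> a \<Longrightarrow> delete f (contract a H) = contract a (delete f H)"
  by (auto simp: contract_def delete_def)

text \<open>Maker copies her moves: the subset \<open>B\<close> of \<open>A\<close> is completed at
  the latest when \<open>A\<close> is, and Breaker cannot hit \<open>B\<close> without hitting
  \<open>A\<close>.\<close>

lemma maker_wins_mono:
  assumes "maker_wins H" and "\<And>A. A \<in> H \<Longrightarrow> \<exists>B\<in>H'. B \<subseteq> A"
  shows "maker_wins H'"
  using assms
proof (induction arbitrary: H' rule: maker_wins.induct)
  case (won H)
  from won.prems[OF won.hyps] have "{} \<in> H'" by simp
  then show ?case by (rule maker_wins.won)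
next
  case (move e H)
  show ?case
  proof (rule maker_wins.move[of e], rule move.IH)
    fix f A
    assume "A \<in> delete f (contract e H)"
    then obtain A' where A': "A' \<in> H" "A = A' - {e}" "f \<notin> A"
      by (auto simp: delete_def contract_def)
    with move.prems obtain B where "B \<in> H'" "B \<subseteq> A'" by blast
    with A' show "\<exists>B\<in>delete f (contract e H'). B \<subseteq> A"
      by (intro bexI[of _ "B - {e}"]) (auto simp: delete_def contract_def)
  qed
qed

lemma maker_wins_subset: "maker_wins H \<Longrightarrow> H \<subseteq> H' \<Longrightarrow> maker_wins H'"
  by (erule maker_wins_mono) blast

text \<open>Confining Maker to elements that still occur in \<open>H\<close> makes her move legal in
  the actual game.\<close>

lemma maker_wins_cases:
  assumes "maker_wins H"
  obtains "{} \<in> H" | e where "e \<in> \<Union>H" "\<And>f. maker_wins (delete f (contract e H))"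
proof -
  from assms have "{} \<in> H \<or> (\<exists>e\<in>\<Union>H. \<forall>f. maker_wins (delete f (contract e H)))"
  proof (induction rule: maker_wins.induct)
    case (move e H)
    show ?case
    proof (cases "e \<in> \<Union>H")
      case True
      with move.hyps show ?thesis by blast
    next
      case False
      \<comment> \<open>Answering an idle \<open>e\<close> with \<open>e\<close> itself leaves
        \<open>H\<close> unchanged, so this instance of the induction hypothesis already speaks
        about \<open>H\<close>.\<close>
      with move.IH[of e] show ?thesis by (simp add: contract_idle delete_idle)
    qed
  qed blast
  with that show thesis by blast
qed

lemma not_maker_wins_empty: "\<not> maker_wins {}"
  by (auto elim: maker_wins_cases)

section \<open>From the residual hypergraph to strategies\<close>

lemma claimed_Nil [simp]: "claimed P [] = {}"
  by (simp add: claimed_def)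

lemma claimed_snoc:
  "claimed P (p @ [e]) = (if to_move p = P then insert e (claimed P p) else claimed P p)"
proof -
  define I where "I q = {m. m < length q \<and> to_move (take m q) = P}" for q :: "'a list"
  have claimed: "claimed P q = (!) q ` I q" for q
    by (auto simp: claimed_def I_def)
  have "I (p @ [e]) = I p \<union> (if to_move p = P then {length p} else {})"
    by (auto simp: I_def less_Suc_eq)
  moreover have "(!) (p @ [e]) ` I p = (!) p ` I p"
    by (rule image_cong) (auto simp: I_def nth_append)
  ultimately show ?thesis
    by (simp add: claimed)
qed

lemma claimed_subset: "claimed P p \<subseteq> set p"
  by (auto simp: claimed_def)

lemma claimed_Un: "claimed Maker p \<union> claimed Breaker p = set p"
  by (induction p rule: rev_induct) (use player.exhaust in \<open>auto simp: claimed_snoc\<close>)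

lemma to_move_Maker: "to_move p = Maker \<longleftrightarrow> even (length p)"
  and to_move_Breaker: "to_move p = Breaker \<longleftrightarrow> odd (length p)"
  by (simp_all add: to_move_def)

lemma claimed_disjoint: "distinct p \<Longrightarrow> claimed Maker p \<inter> claimed Breaker p = {}"
proof (induction p rule: rev_induct)
  case (snoc e p)
  then show ?case
    using claimed_subset[of Maker p] claimed_subset[of Breaker p]
    by (auto simp: claimed_snoc to_move_def)
qed simp

lemma winning_strategy_if_invariant:
  assumes init: "Q []"
    and own: "\<And>p. \<lbrakk>position X p; set p \<noteq> X; to_move p = P; Q p\<rbrakk> \<Longrightarrow> \<exists>e\<in>X - set p. Q (p @ [e])"
    and other: "\<And>p e. \<lbrakk>position X p; e \<in> X - set p; to_move p \<noteq> P; Q p\<rbrakk> \<Longrightarrow> Q (p @ [e])"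
    and final: "\<And>p. \<lbrakk>position X p; set p = X; Q p\<rbrakk> \<Longrightarrow> winner F p = P"
  shows "has_winning_strategy P X F"
proof -
  \<comment> \<open>The implication keeps the choice legal at positions where \<open>Q\<close>
    fails, since \<open>strategy\<close> demands legality at every position.\<close>
  define s where "s p = (SOME e. e \<in> X - set p \<and> (Q p \<longrightarrow> Q (p @ [e])))" for p
  have s: "s p \<in> X - set p \<and> (Q p \<longrightarrow> Q (p @ [s p]))"
    if "position X p" "set p \<noteq> X" "to_move p = P" for p
  proof -
    have "\<exists>e. e \<in> X - set p \<and> (Q p \<longrightarrow> Q (p @ [e]))"
      using own[OF that] that by (auto simp: position_def)
    then show ?thesis unfolding s_def by (rule someI_ex)
  qed
  have Q: "Q p" if "position X p" "follows P s p" for p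
    using that
  proof (induction p rule: rev_induct)
    case Nil
    show ?case by (rule init)
  next
    case (snoc e p)
    have pos: "position X p" and e: "e \<in> X - set p"
      using snoc.prems by (auto simp: position_def)
    have "follows P s p"
      unfolding follows_def
    proof (intro allI impI)
      fix m assume "m < length p" "to_move (take m p) = P"
      with snoc.prems(2) show "p ! m = s (take m p)"
        unfolding follows_def by (auto simp: nth_append dest!: spec[of _ m])
    qed
    with pos snoc.IH have "Q p" by blast
    show ?case
    proof (cases "to_move p = P")
      case True
      then have "e = s p"
        using snoc.prems(2) unfolding follows_def by (auto dest!: spec[of _ "length p"])
      with s[OF pos _ True] e \<open>Q p\<close> show ?thesis by blast
    next
      case False
      with other pos e \<open>Q p\<close> show ?thesis by blast
    qed
  qed
  have "strategy P X s"
    using s by (auto simp: strategy_def)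
  with Q final show ?thesis
    unfolding has_winning_strategy_def by blast
qed

text \<open>Determinacy: Maker can preserve \<open>Q\<close>, Breaker can preserve its negation, and
  at the end of the game \<open>Q\<close> says that Maker has won.\<close>

lemma winning_strategy_residual:
  assumes F: "\<And>A. A \<in> F \<Longrightarrow> A \<subseteq> X"
  shows "has_winning_strategy (if maker_wins F then Maker else Breaker) X F"
proof -
  define res where "res p = residual F (claimed Maker p) (claimed Breaker p)" for p
  define Q where "Q p \<longleftrightarrow>
    (if even (length p) then maker_wins (res p) else \<forall>f. maker_wins (delete f (res p)))" for p
  have res_Maker: "res (p @ [e]) = contract e (res p)" if "even (length p)" for p e
    using that by (simp add: res_def claimed_snoc to_move_def contract_residual)
  have res_Breaker: "res (p @ [e]) = delete e (res p)" if "odd (length p)" "e \<notin> set p" for p e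
  proof -
    have "e \<notin> claimed Maker p" using that claimed_subset[of Maker p] by blast
    with that show ?thesis by (simp add: res_def claimed_snoc to_move_def delete_residual)
  qed
  have res_free: "\<Union>(res p) \<subseteq> X - set p" for p
    using F by (fastforce simp: res_def residual_def claimed_Un[symmetric])
  have init: "Q [] \<longleftrightarrow> maker_wins F"
    by (simp add: Q_def res_def)
  have Q_res: "maker_wins (res p)" if "Q p" for p
    using that by (auto simp: Q_def delete_def split: if_splits intro: maker_wins_subset)
  have Q_if_won: "Q p" if "{} \<in> res p" for p
    using that by (auto simp: Q_def delete_def intro: maker_wins.won)
  have Q_final: "Q p \<longleftrightarrow> winner F p = Maker" if p: "position X p" "set p = X" for p
  proof
    assume "Q p"
    \<comment> \<open>No free element remains, so no member of the residual offers Maker a move and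
      only the case of a completed set is left.\<close>
    from Q_res[OF this] have "{} \<in> res p"
      using res_free[of p] p by (auto elim: maker_wins_cases)
    then show "winner F p = Maker"
      by (auto simp: res_def residual_def winner_def)
  next
    assume "winner F p = Maker"
    then obtain A where A: "A \<in> F" "A \<subseteq> claimed Maker p"
      by (auto simp: winner_def split: if_splits)
    moreover from p A have "A \<inter> claimed Breaker p = {}"
      using claimed_disjoint[of p] by (auto simp: position_def)
    ultimately have "{} \<in> res p"
      unfolding res_def residual_def by blast
    then show "Q p" by (rule Q_if_won)
  qed
  show ?thesis
  proof (cases "maker_wins F")
    case True
    have "has_winning_strategy Maker X F"
    proof (rule winning_strategy_if_invariant[of Q])
      show "Q []" using init True by simp
      show "winner F p = Maker" if "position X p" "set p = X" "Q p" for p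
        using that Q_final by blast
      show "Q (p @ [e])" if "e \<in> X - set p" "to_move p \<noteq> Maker" "Q p" for p e
        using that by (auto simp: Q_def to_move_def res_Breaker split: if_splits)
      show "\<exists>e\<in>X - set p. Q (p @ [e])"
        if p: "position X p" "set p \<noteq> X" "to_move p = Maker" "Q p" for p
      proof -
        have ev: "even (length p)" using p by (simp add: to_move_Maker)
        from Q_res[OF \<open>Q p\<close>] show ?thesis
        proof (cases rule: maker_wins_cases)
          case 1
          \<comment> \<open>Maker owns a winning set already, so any free element will do.\<close>
          from p obtain e where e: "e \<in> X - set p" by (auto simp: position_def)
          from 1 have "{} \<in> res (p @ [e])"
            by (force simp: res_Maker[OF ev] contract_def)
          with e Q_if_won show ?thesis by blast
        next
          case (2 e)
          then have "Q (p @ [e])" by (simp add: Q_def ev res_Maker)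
          with 2 res_free[of p] show ?thesis by blast
        qed
      qed
    qed
    with True show ?thesis by simp
  next
    case False
    have "has_winning_strategy Breaker X F"
    proof (rule winning_strategy_if_invariant[of "\<lambda>p. \<not> Q p"])
      show "\<not> Q []" using init False by simp
      show "winner F p = Breaker" if "position X p" "set p = X" "\<not> Q p" for p
        using that Q_final player.exhaust by blast
      show "\<not> Q (p @ [e])" if p: "to_move p \<noteq> Breaker" "\<not> Q p" for p e
      proof -
        have ev: "even (length p)" using p by (simp add: to_move_Breaker)
        with p show ?thesis
          by (auto simp: Q_def res_Maker intro: maker_wins.move)
      qed
      show "\<exists>e\<in>X - set p. \<not> Q (p @ [e])"
        if p: "position X p" "set p \<noteq> X" "to_move p = Breaker" "\<not> Q p" for p
      proof -
        have od: "odd (length p)" using p by (simp add: to_move_Breaker)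
        with p obtain f where f: "\<not> maker_wins (delete f (res p))" by (auto simp: Q_def)
        show ?thesis
        proof (cases "f \<in> X - set p")
          case True
          with f od show ?thesis by (auto simp: Q_def res_Breaker intro!: bexI[of _ f])
        next
          case False
          \<comment> \<open>Here Breaker's good answer is a pass, which the game forbids. He takes
            an arbitrary free element instead; deleting more sets cannot hurt him.\<close>
          with res_free[of p] have "delete f (res p) = res p" by (intro delete_idle) blast
          with f have "\<not> maker_wins (res p)" by simp
          moreover from p obtain e where e: "e \<in> X - set p" by (auto simp: position_def)
          ultimately have "\<not> maker_wins (delete e (res p))"
            by (auto simp: delete_def intro: maker_wins_subset)
          with e od show ?thesis by (auto simp: Q_def res_Breaker intro!: bexI[of _ e])
        qed
      qed
    qed
    with False show ?thesis by simp
  qed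
qed

section \<open>Threats and pairings\<close>

lemma maker_wins_threat:
  assumes "A \<in> H" "A \<subseteq> {f}"
  shows "maker_wins H"
proof (rule maker_wins.move[of f], rule maker_wins.won)
  fix g
  from assms show "{} \<in> delete g (contract f H)"
    by (force simp: delete_def contract_def)
qed

text \<open>Once Maker has claimed \<open>e\<close>, the set \<open>A\<close> lacks at most
  \<open>f\<close>; any reply other than \<open>f\<close> lets her complete it.\<close>

lemma maker_wins_forcing:
  assumes "A \<in> F" "A \<inter> B = {}" "A \<subseteq> insert e (insert f M)" "f \<notin> insert e M"
    and "maker_wins (residual F (insert e M) (insert f B))"
  shows "maker_wins (residual F M B)"
proof (rule maker_wins.move[of e])
  fix g
  show "maker_wins (delete g (contract e (residual F M B)))"
  proof (cases "g = f")
    case True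
    with assms show ?thesis by (simp add: contract_residual delete_residual)
  next
    case False
    with assms have "A - insert e M \<in> delete g (contract e (residual F M B))"
      unfolding contract_residual by (auto simp: delete_def residual_def)
    then show ?thesis
      by (rule maker_wins_threat[of _ _ f]) (use assms in auto)
  qed
qed

lemma maker_wins_double_threat:
  assumes "A \<in> F" "A \<inter> B = {}" "A \<subseteq> insert e (insert f M)" "f \<notin> insert e M"
    and "A' \<in> F" "A' \<inter> B = {}" "A' \<subseteq> insert e (insert g M)" "f \<noteq> g" "f \<notin> A'"
  shows "maker_wins (residual F M B)"
  by (rule maker_wins_forcing[OF assms(1-4)],
      rule maker_wins_threat[of "A' - insert e M" _ g])
    (use assms in \<open>auto simp: residual_def\<close>)

text \<open>If \<open>b\<close> lies in no other winning set, Breaker answers \<open>a\<close> with \<open>b\<close> and \<open>b\<close> with \<open>a\<close>. Apart from this,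
  he plays as if Maker already owned \<open>a\<close>.\<close>

lemma maker_wins_pair:
  assumes "maker_wins G" and "\<And>A. A \<in> G \<Longrightarrow> {a, b} \<subseteq> A \<or> (\<exists>B\<in>H. B \<subseteq> A)"
    and "a \<noteq> b" "b \<notin> \<Union>H"
  shows "maker_wins (contract a H)"
  using assms
proof (induction arbitrary: H rule: maker_wins.induct)
  case (won G)
  then have "{} \<in> H" by fastforce
  then have "{} \<in> contract a H" by (force simp: contract_def)
  then show ?case by (rule maker_wins.won)
next
  case (move e G)
  consider "e = a" | "e = b" | "e \<noteq> a" "e \<noteq> b" by blast
  then show ?case
  proof cases
    case 1
    show ?thesis
    proof (rule maker_wins_mono[OF move.hyps[of b]])
      fix A assume "A \<in> delete b (contract e G)"
      then obtain A' where A': "A' \<in> G" "A = A' - {a}" "b \<notin> A'"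
        using 1 move.prems by (auto simp: delete_def contract_def)
      with move.prems(1)[of A'] obtain B where "B \<in> H" "B \<subseteq> A'" by blast
      with A' show "\<exists>B\<in>contract a H. B \<subseteq> A" by (auto simp: contract_def)
    qed
  next
    case 2
    show ?thesis
    proof (rule maker_wins_mono[OF move.hyps[of a]])
      fix A assume "A \<in> delete a (contract e G)"
      then obtain A' where A': "A' \<in> G" "A = A' - {b}" "a \<notin> A'"
        using 2 move.prems by (auto simp: delete_def contract_def)
      with move.prems(1)[of A'] obtain B where "B \<in> H" "B \<subseteq> A'" by blast
      with A' move.prems(3) show "\<exists>B\<in>contract a H. B \<subseteq> A"
        by (fastforce simp: contract_def)
    qed
  next
    case 3
    \<comment> \<open>Outside the pair, Breaker's reply is the one from the game on
      \<open>H\<close>; the pair stays intact and the remaining sets still dominate those of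
      \<open>G\<close>.\<close>
    have *: "maker_wins (contract a (delete f (contract e H)))" if "f \<noteq> a" "f \<noteq> b" for f
    proof (rule move.IH[of f])
      fix A assume "A \<in> delete f (contract e G)"
      then obtain A' where A': "A' \<in> G" "A = A' - {e}" "f \<notin> A"
        by (auto simp: delete_def contract_def)
      from move.prems(1)[OF A'(1)]
      show "{a, b} \<subseteq> A \<or> (\<exists>B\<in>delete f (contract e H). B \<subseteq> A)"
      proof
        assume "\<exists>B\<in>H. B \<subseteq> A'"
        then obtain B where "B \<in> H" "B \<subseteq> A'" by blast
        with A' have "B - {e} \<in> delete f (contract e H)" "B - {e} \<subseteq> A"
          by (auto simp: delete_def contract_def)
        then show ?thesis by blast
      qed (use A' 3 in auto)
    qed (use move.prems in \<open>auto simp: delete_def contract_def\<close>)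
    show ?thesis
    proof (rule maker_wins.move[of e])
      fix f
      show "maker_wins (delete f (contract e (contract a H)))"
      proof (cases "f = a \<or> f = b")
        case True
        \<comment> \<open>Neither \<open>a\<close> nor \<open>b\<close> occurs in the contracted
          hypergraph, so this reply is a pass, covered by \<open>*\<close> with
          \<open>f = e\<close>.\<close>
        have "maker_wins (contract a (delete e (contract e H)))"
          using * 3 by blast
        moreover have "f \<notin> \<Union>(contract a (contract e H))"
          using True move.prems(3) by (auto simp: contract_def)
        ultimately show ?thesis
          by (subst contract_commute) (simp add: delete_idle contract_def)
      next
        case False
        with *[of f] show ?thesis
          by (subst contract_commute) (simp add: delete_contract)
      qed
    qed
  qed
qed

text \<open>Maker owns \<open>e\<close> already and is to move once more.\<close>

definition breaker_wins_late :: "'e set set \<Rightarrow> bool" where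
  "breaker_wins_late H \<longleftrightarrow> (\<forall>e. \<not> maker_wins (contract e H))"

lemma breaker_wins_late_empty: "breaker_wins_late {}"
  by (simp add: breaker_wins_late_def contract_def not_maker_wins_empty)

text \<open>Pairing two remaining elements of the new set, one of them absent from \<open>H\<close>,
  costs Breaker at most the other. If Maker's first move was \<open>y\<close> or \<open>z\<close>,
  it was idle on \<open>H\<close>, and conceding \<open>x\<close> merely uses up her free move;
  otherwise \<open>y\<close> and \<open>z\<close> are paired, which concedes nothing on
  \<open>H\<close>.\<close>

lemma breaker_wins_late_insert:
  assumes H: "breaker_wins_late H"
    and "x \<noteq> y" "x \<noteq> z" "y \<noteq> z" "y \<notin> \<Union>H" "z \<notin> \<Union>H"
  shows "breaker_wins_late (insert {x, y, z} H)"
  unfolding breaker_wins_late_def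
proof (intro allI notI)
  fix e
  assume win: "maker_wins (contract e (insert {x, y, z} H))"
  have pair: False if "a \<in> {x, y, z} - {e}" "b \<in> {x, y, z} - {e}" "a \<noteq> b" "b \<notin> \<Union>H"
    "\<not> maker_wins (contract a (contract e H))" for a b
  proof -
    have "maker_wins (contract a (contract e H))"
    proof (rule maker_wins_pair[OF win])
      fix A assume "A \<in> contract e (insert {x, y, z} H)"
      with that show "{a, b} \<subseteq> A \<or> (\<exists>B\<in>contract e H. B \<subseteq> A)"
        unfolding contract_insert by blast
    qed (use that in \<open>auto simp: contract_def\<close>)
    with that show False by blast
  qed
  consider "e = y" | "e = z" | "e \<noteq> y" "e \<noteq> z" by blast
  then show False
  proof cases
    case 1
    with assms pair[of x z] show False by (simp add: contract_idle breaker_wins_late_def)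
  next
    case 2
    with assms pair[of x y] show False by (simp add: contract_idle breaker_wins_late_def)
  next
    case 3
    with assms pair[of y z] contract_commute[of y e H] show False
      by (simp add: contract_idle breaker_wins_late_def)
  qed
qed

section \<open>The triangles of the parity tournament\<close>

definition cyclic_triangle :: "nat \<Rightarrow> nat \<Rightarrow> nat \<Rightarrow> (nat \<times> nat) set" where
  "cyclic_triangle i j k = {(i, j), (j, k), (k, i)}"

text \<open>Ascending arcs have odd sum and descending arcs even sum. The three sums add up to an
  even number, so a directed triangle has an even number of ascents; a cycle has at least one, hence
  exactly two. Rotating makes the descent the closing arc.\<close>

lemma triangle_edge_sets_parity_tournament:
  "triangle_edge_sets (parity_tournament n) =
    {cyclic_triangle i j k | i j k.
      1 \<le> i \<and> i < j \<and> j < k \<and> k \<le> n \<and> odd (i + j) \<and> odd (j + k)}"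
  (is "?L = ?R")
proof
  have arc: "(i, j) \<in> parcs (parity_tournament n) \<longleftrightarrow>
      1 \<le> i \<and> i \<le> n \<and> 1 \<le> j \<and> j \<le> n \<and> (i < j \<and> odd (i + j) \<or> j < i \<and> even (i + j))" for i j
    by (auto simp: parity_tournament_def)
  show "?R \<subseteq> ?L"
  proof
    fix A assume "A \<in> ?R"
    then obtain i j k where A: "A = cyclic_triangle i j k" and
      ijk: "1 \<le> i" "i < j" "j < k" "k \<le> n" "odd (i + j)" "odd (j + k)" by blast
    then have "even (k + i)" by presburger
    with ijk have "directed_triangle (parity_tournament n) i j k"
      by (simp add: directed_triangle_def arc) (simp add: parity_tournament_def)
    then show "A \<in> ?L" unfolding triangle_edge_sets_def A cyclic_triangle_def by blast
  qed
  show "?L \<subseteq> ?R"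
  proof
    fix A assume "A \<in> ?L"
    then obtain i j k where A: "A = cyclic_triangle i j k" and
      arcs: "(i, j) \<in> parcs (parity_tournament n)" "(j, k) \<in> parcs (parity_tournament n)"
        "(k, i) \<in> parcs (parity_tournament n)"
      by (auto simp: triangle_edge_sets_def directed_triangle_def cyclic_triangle_def)
    have rot: "A = cyclic_triangle j k i" "A = cyclic_triangle k i j"
      by (auto simp: A cyclic_triangle_def)
    have sorted: "cyclic_triangle a b c \<in> ?R"
      if "(a, b) \<in> parcs (parity_tournament n)" "(b, c) \<in> parcs (parity_tournament n)"
        "a < b" "b < c" for a b c
      using that unfolding arc by fastforce
    from arcs consider "i < j" "j < k" | "j < k" "k < i" | "k < i" "i < j"
      unfolding arc by (smt (verit) even_add not_less_iff_gr_or_eq order.strict_trans)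
    then show "A \<in> ?R"
    proof cases
      case 1
      with arcs show ?thesis unfolding A by (intro sorted)
    next
      case 2
      with arcs show ?thesis unfolding rot(1) by (intro sorted)
    next
      case 3
      with arcs show ?thesis unfolding rot(2) by (intro sorted)
    qed
  qed
qed

lemma triangle_edge_sets_parity_tournament_mono:
  "m \<le> n \<Longrightarrow>
    triangle_edge_sets (parity_tournament m) \<subseteq> triangle_edge_sets (parity_tournament n)"
  unfolding triangle_edge_sets_parity_tournament
  by (intro Collect_mono impI; elim exE conjE; intro exI conjI; (assumption | simp))

section \<open>Breaker on six vertices\<close>

lemma not_maker_wins_6: "\<not> maker_wins (triangle_edge_sets (parity_tournament 6))"
proof
  define T where "T = {cyclic_triangle 2 3 6, cyclic_triangle 1 2 3, cyclic_triangle 4 5 6,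
    cyclic_triangle 1 4 5, cyclic_triangle 3 4 5, cyclic_triangle 2 3 4}"
  let ?H = "triangle_edge_sets (parity_tournament 6)"
  have T: "breaker_wins_late T"
  proof -
    \<comment> \<open>The triangles are listed latest first. In each, the second and third arcs as
      written here are absent from all triangles further down the list, which is the form that
      \<open>breaker_wins_late_insert\<close> expects.\<close>
    have "cyclic_triangle 2 3 6 = {(2, 3), (3, 6), (6, 2)}"
      "cyclic_triangle 1 2 3 = {(2, 3), (1, 2), (3, 1)}"
      "cyclic_triangle 4 5 6 = {(4, 5), (5, 6), (6, 4)}"
      "cyclic_triangle 1 4 5 = {(4, 5), (1, 4), (5, 1)}"
      "cyclic_triangle 3 4 5 = {(3, 4), (4, 5), (5, 3)}"
      "cyclic_triangle 2 3 4 = {(2, 3), (3, 4), (4, 2)}"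
      by (auto simp: cyclic_triangle_def)
    then show ?thesis
      unfolding T_def by (simp add: breaker_wins_late_insert breaker_wins_late_empty)
  qed
  have H: "?H \<subseteq> insert (cyclic_triangle 1 2 5) (insert (cyclic_triangle 2 5 6) T)"
  proof
    fix A assume "A \<in> ?H"
    then obtain i j k where A: "A = cyclic_triangle i j k" and
      ijk: "1 \<le> i" "i < j" "j < k" "k \<le> 6" "odd (i + j)" "odd (j + k)"
      unfolding triangle_edge_sets_parity_tournament by auto
    have "i = 1 \<or> i = 2 \<or> i = 3 \<or> i = 4"
      using ijk(1-4) by linarith
    moreover have "j = i + 1 \<or> j = i + 3"
      using ijk(1-3,5) \<open>k \<le> 6\<close> by presburger
    moreover have "k = j + 1 \<or> k = j + 3"
      using ijk(1-4,6) by presburger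
    ultimately have "(i, j, k) \<in> {(1, 2, 3), (2, 3, 4), (3, 4, 5), (4, 5, 6), (1, 2, 5), (2, 3, 6),
        (1, 4, 5), (2, 5, 6)}"
      using \<open>k \<le> 6\<close> by (elim disjE) simp_all
    then show "A \<in> insert (cyclic_triangle 1 2 5) (insert (cyclic_triangle 2 5 6) T)"
      unfolding A T_def by blast
  qed
  have T_contract: "\<not> maker_wins K" if "K \<subseteq> contract e T" for K e
    using T that maker_wins_subset unfolding breaker_wins_late_def by blast
  assume "maker_wins ?H"
  with H have "maker_wins (insert (cyclic_triangle 1 2 5) (insert (cyclic_triangle 2 5 6) T))"
    by (rule maker_wins_subset[rotated])
  then show False
  proof (cases rule: maker_wins_cases)
    case 1
    then show ?thesis by (auto simp: T_def cyclic_triangle_def)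
  next
    case (2 e)
    show ?thesis
    proof (cases "e = (2, 5)")
      case False
      then have "delete (2, 5)
          (contract e (insert (cyclic_triangle 1 2 5) (insert (cyclic_triangle 2 5 6) T)))
          \<subseteq> contract e T"
        by (auto simp: contract_insert delete_def cyclic_triangle_def)
      with T_contract 2 show ?thesis by blast
    next
      case True
      \<comment> \<open>Taking 12 also hits the triangle 123; \<open>?K\<close> gives up this gain
        in order to keep \<open>T\<close> whole.\<close>
      let ?K = "insert {(5, 6), (6, 2)} T"
      have "contract e T = T"
        using True by (intro contract_idle) (simp add: T_def cyclic_triangle_def)
      moreover have "(1, 2) \<in> cyclic_triangle 1 2 5 - {e}"
        "cyclic_triangle 2 5 6 - {e} = {(5, 6), (6, 2)}"
        using True by (simp_all add: cyclic_triangle_def insert_Diff_if)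
      ultimately have "delete (1, 2)
          (contract e (insert (cyclic_triangle 1 2 5) (insert (cyclic_triangle 2 5 6) T))) \<subseteq> ?K"
        unfolding contract_insert delete_def by blast
      with 2(2)[of "(1, 2)"] have "maker_wins ?K" by (rule maker_wins_subset)
      then show ?thesis
      proof (cases rule: maker_wins_cases)
        case 1
        then show ?thesis by (auto simp: T_def cyclic_triangle_def)
      next
        case (2 e')
        \<comment> \<open>Maker cannot have taken both arcs, and the free one destroys the rest of
          256. On \<open>T\<close> she has then made one move and is to move again, as in
          \<open>breaker_wins_late\<close>.\<close>
        have "(5, 6) \<noteq> e' \<or> (6, 2) \<noteq> e'" by auto
        then obtain f where "f \<in> {(5, 6), (6, 2)} - {e'}" by blast
        then have "delete f (contract e' ?K) \<subseteq> contract e' T"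
          unfolding contract_insert delete_def by blast
        with T_contract 2 show ?thesis by blast
      qed
    qed
  qed
qed

section \<open>Maker on seven vertices\<close>

lemma maker_wins_7: "maker_wins (triangle_edge_sets (parity_tournament 7))"
proof -
  let ?F = "triangle_edge_sets (parity_tournament 7)"
  have F: "cyclic_triangle i j k \<in> ?F"
    if "1 \<le> i" "i < j" "j < k" "k \<le> 7" "odd (i + j)" "odd (j + k)" for i j k
    using that unfolding triangle_edge_sets_parity_tournament by blast
  have answer: "maker_wins (residual ?F {(1, 2)} {f})" if "f \<noteq> (1, 2)" for f
  proof -
    \<comment> \<open>The two seven-element sets collect the arcs other than 12 of the triangles
      used in the first and second sequence. They share only 25 and 15, and no triangle of the third
      sequence contains either of these.\<close>
    have "f \<notin> {(7, 1), (2, 7), (5, 1), (2, 5), (1, 4), (4, 5), (4, 7)}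
        \<or> f \<notin> {(2, 3), (3, 1), (2, 5), (5, 1), (6, 2), (3, 6), (5, 6)} \<or> f \<in> {(2, 5), (5, 1)}"
      by auto
    then consider (1) "f \<notin> {(7, 1), (2, 7), (5, 1), (2, 5), (1, 4), (4, 5), (4, 7)}"
      | (2) "f \<notin> {(2, 3), (3, 1), (2, 5), (5, 1), (6, 2), (3, 6), (5, 6)}"
      | (3) "f \<in> {(2, 5), (5, 1)}"
      by blast
    then show ?thesis
    proof cases
      case 1
      \<comment> \<open>Each sequence is verified backwards, from the final double threat to the
        first forcing move.\<close>
      have threat: "maker_wins (residual ?F {(5, 1), (7, 1), (1, 2)} {(2, 5), (2, 7), f})"
        by (rule maker_wins_double_threat[OF F[of 1 4 5] _ _ _ F[of 1 4 7],
              of _ "(1, 4)" "(4, 5)" _ "(4, 7)"])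
          (use 1 in \<open>auto simp: cyclic_triangle_def\<close>)
      have threat: "maker_wins (residual ?F {(7, 1), (1, 2)} {(2, 7), f})"
        by (rule maker_wins_forcing[OF F[of 1 2 5], where e = "(5, 1)" and f = "(2, 5)"])
          (use 1 that threat in \<open>auto simp: cyclic_triangle_def\<close>)
      show ?thesis
        by (rule maker_wins_forcing[OF F[of 1 2 7], where e = "(7, 1)" and f = "(2, 7)"])
          (use 1 that threat in \<open>auto simp: cyclic_triangle_def\<close>)
    next
      case 2
      have threat: "maker_wins (residual ?F {(2, 5), (2, 3), (1, 2)} {(5, 1), (3, 1), f})"
        by (rule maker_wins_double_threat[OF F[of 2 3 6] _ _ _ F[of 2 5 6],
              of _ "(6, 2)" "(3, 6)" _ "(5, 6)"])
          (use 2 in \<open>auto simp: cyclic_triangle_def\<close>)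
      have threat: "maker_wins (residual ?F {(2, 3), (1, 2)} {(3, 1), f})"
        by (rule maker_wins_forcing[OF F[of 1 2 5], where e = "(2, 5)" and f = "(5, 1)"])
          (use 2 that threat in \<open>auto simp: cyclic_triangle_def\<close>)
      show ?thesis
        by (rule maker_wins_forcing[OF F[of 1 2 3], where e = "(2, 3)" and f = "(3, 1)"])
          (use 2 that threat in \<open>auto simp: cyclic_triangle_def\<close>)
    next
      case 3
      have threat: "maker_wins
          (residual ?F {(7, 1), (3, 4), (2, 3), (1, 2)} {(2, 7), (4, 2), (3, 1), f})"
        by (rule maker_wins_double_threat[OF F[of 1 4 7] _ _ _ F[of 3 4 7],
              of _ "(4, 7)" "(1, 4)" _ "(7, 3)"])
          (use 3 in \<open>auto simp: cyclic_triangle_def\<close>)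
      have threat: "maker_wins (residual ?F {(3, 4), (2, 3), (1, 2)} {(4, 2), (3, 1), f})"
        by (rule maker_wins_forcing[OF F[of 1 2 7], where e = "(7, 1)" and f = "(2, 7)"])
          (use 3 that threat in \<open>auto simp: cyclic_triangle_def\<close>)
      have threat: "maker_wins (residual ?F {(2, 3), (1, 2)} {(3, 1), f})"
        by (rule maker_wins_forcing[OF F[of 2 3 4], where e = "(3, 4)" and f = "(4, 2)"])
          (use 3 that threat in \<open>auto simp: cyclic_triangle_def\<close>)
      show ?thesis
        by (rule maker_wins_forcing[OF F[of 1 2 3], where e = "(2, 3)" and f = "(3, 1)"])
          (use 3 that threat in \<open>auto simp: cyclic_triangle_def\<close>)
    qed
  qed
  have "maker_wins (delete f (contract (1, 2) (residual ?F {} {})))" for f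
  proof (cases "f = (1, 2)")
    case True
    \<comment> \<open>Replying with the arc that Maker owns is a pass. The loop at 1, which lies in
      no triangle, stands in for it so that \<open>answer\<close> applies.\<close>
    have "residual ?F {(1, 2)} {(1, 1)} \<subseteq> delete f (contract (1, 2) ?F)"
      using True by (auto simp: residual_def delete_def contract_def)
    with answer[of "(1, 1)"] show ?thesis by (auto intro: maker_wins_subset)
  next
    case False
    with answer[of f] show ?thesis by (simp only: contract_residual) (simp add: delete_residual)
  qed
  then have "maker_wins (residual ?F {} {})" by (rule maker_wins.move)
  then show ?thesis by simp
qed

theorem theorem2p1:
  fixes n :: nat
  shows "(n \<le> 6 \<longrightarrow> wins_triangle_game Breaker (parity_tournament n)) \<and>
         (n \<ge> 7 \<longrightarrow> wins_triangle_game Maker (parity_tournament n))"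
proof -
  let ?F = "\<lambda>n. triangle_edge_sets (parity_tournament n)"
  have wins: "wins_triangle_game (if maker_wins (?F n) then Maker else Breaker)
      (parity_tournament n)"
    unfolding wins_triangle_game_def
    by (rule winning_strategy_residual) (auto simp: triangle_edge_sets_def directed_triangle_def)
  have "\<not> maker_wins (?F n)" if "n \<le> 6"
    using that not_maker_wins_6 triangle_edge_sets_parity_tournament_mono maker_wins_subset
    by blast
  moreover have "maker_wins (?F n)" if "n \<ge> 7"
    using that maker_wins_7 triangle_edge_sets_parity_tournament_mono maker_wins_subset
    by blast
  ultimately show ?thesis
    using wins by auto
qed

end
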